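(* The moment fitting weighted regression function $$\sum_{i=1}^{l}w_i\left(i!\,(-1)^i\,\bm\alpha\,\bm T^{-i}\,\mathbf{1}_n-m_i\right)^2$$ is a differentiable function of $\bm\alpha,\bm T$, and hence can be optimized in the space of the new parametrization $(\bm a,\bm\gamma,\bm Z)$ using gradient descent. The resulting point in the new parametrization is then guaranteed to be mapped back (by the map $\pi$) to a valid phase type (PH) distribution in the Markovian parametrization.
   Context: A PH distribution of size $n$ in the Markovian parametrization is a pair $(\bm\alpha,\bm T)$ with $\bm\alpha\in\mathbb{R}^{1\times n}$ and $\bm T\in\mathbb{R}^{n\times n}$ such that $\alpha_i\ge 0$ for all $i$, $\sum_i\alpha_i=1$, $T_{ij}\ge 0$ for all $i\ne j$, $\sum_j T_{ij}\le 0$ for all $i$, and $\bm T$ is non-singular. Its $i$-th moment is $i!\,(-1)^i\bm\alpha\bm T^{-i}\mathbf{1}_n$, where $\mathbf{1}_n$ is the length-$n$ vector of ones. The number $l$ is the number of moments to fit, $m_i$ is the target $i$-th moment, and $w_i$ are weights for the terms. The new parameters are $\bm a\in\mathbb{R}^n$, $\bm\gamma\in(\mathbb{R}\setminus\{0\})^n$ and an $n\times n$ real matrix $\bm Z$; they are mapped to Markovian parameters $(\bm\alpha,\bm T)$ by the differentiable map $\pi=(\pi_\alpha,\pi_T)$, $$\pi_\alpha(\bm a,\bm\gamma,\bm Z)=\mathrm{softmax}(\bm a),\qquad \pi_T(\bm a,\bm\gamma,\bm Z)=\mathrm{diag}(\bm\gamma^2)\cdot\left[\mathrm{softmax}(\bm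 Z)-\left(\bm I_n+\mathrm{softmax}(\bm Z)\circ\bm I_n\right)\right],$$ where $\mathrm{softmax}(\bm v)_i=e^{v_i}/\sum_{j}e^{v_j}$ for vectors and softmax is applied row by row to matrices, $\mathrm{diag}(\bm\gamma^2)$ is the diagonal matrix with $i$-th diagonal element $\gamma_i^2$, $\bm I_n$ is the identity matrix, and $\circ$ is the elementwise matrix product. Optimizing in the new parametrization means minimizing the function obtained by substituting $\bm\alpha=\pi_\alpha(\bm a,\bm\gamma,\bm Z)$ and $\bm T=\pi_T(\bm a,\bm\gamma,\bm Z)$. *)

theory Defs
  imports "HOL-Analysis.Analysis"
begin

text \<open>
  The size \<open>n\<close> of a phase-type distribution is \<open>CARD('n)\<close>. On \<open>real ^ 'n ^ 'n\<close> the operations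
  \<open>*\<close> and \<open>^\<close> are componentwise, so matrix powers are defined through \<open>**\<close>.
\<close>

primrec mat_power :: "real ^ 'n ^ 'n \<Rightarrow> nat \<Rightarrow> real ^ 'n ^ 'n" where
  "mat_power A 0 = mat 1"
| "mat_power A (Suc k) = A ** mat_power A k"

definition hadamard :: "real ^ 'n ^ 'm \<Rightarrow> real ^ 'n ^ 'm \<Rightarrow> real ^ 'n ^ 'm" where
  "hadamard A B = (\<chi> i j. A $ i $ j * B $ i $ j)"

definition diag_mat :: "real ^ 'n \<Rightarrow> real ^ 'n ^ 'n" where
  "diag_mat d = (\<chi> i j. if i = j then d $ i else 0)"

definition softmax :: "real ^ 'n \<Rightarrow> real ^ 'n" where
  "softmax v = (\<chi> i. exp (v $ i) / (\<Sum>j\<in>UNIV. exp (v $ j)))"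

definition softmax_rows :: "real ^ 'n ^ 'm \<Rightarrow> real ^ 'n ^ 'm" where
  "softmax_rows Z = (\<chi> i. softmax (row i Z))"


type_synonym 'n markovian = "(real ^ 'n) \<times> (real ^ 'n ^ 'n)"

fun is_PH :: "'n::finite markovian \<Rightarrow> bool" where
  "is_PH (\<alpha>, T) \<longleftrightarrow>
     (\<forall>i. 0 \<le> \<alpha> $ i) \<and> (\<Sum>i\<in>UNIV. \<alpha> $ i) = 1 \<and>
     (\<forall>i j. i \<noteq> j \<longrightarrow> 0 \<le> T $ i $ j) \<and>
     (\<forall>i. (\<Sum>j\<in>UNIV. T $ i $ j) \<le> 0) \<and>
     invertible T"

text \<open>
  \<open>T\<^sup>-\<^sup>i\<close> is the \<open>i\<close>-th power of the inverse. The library's \<open>matrix_inv T\<close> is unspecified for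
  singular \<open>T\<close>, so the moments are meaningful on the open set of pairs with \<open>T\<close> invertible.
\<close>

fun moment :: "nat \<Rightarrow> 'n::finite markovian \<Rightarrow> real" where
  "moment i (\<alpha>, T) =
     fact i * (- 1) ^ i * ((\<alpha> v* mat_power (matrix_inv T) i) \<bullet> vec 1)"

definition moment_loss ::
  "nat \<Rightarrow> (nat \<Rightarrow> real) \<Rightarrow> (nat \<Rightarrow> real) \<Rightarrow> 'n::finite markovian \<Rightarrow> real" where
  "moment_loss l w m p = (\<Sum>i=1..l. w i * (moment i p - m i)\<^sup>2)"


type_synonym 'n param = "(real ^ 'n) \<times> (real ^ 'n) \<times> (real ^ 'n ^ 'n)"

definition param_space :: "'n::finite param set" where
  "param_space = {(a, \<gamma>, Z). \<forall>i. \<gamma> $ i \<noteq> 0}"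

fun param_map :: "'n::finite param \<Rightarrow> 'n markovian" where
  "param_map (a, \<gamma>, Z) =
     (softmax a,
      diag_mat (\<chi> i. (\<gamma> $ i)\<^sup>2) **
        (softmax_rows Z - (mat 1 + hadamard (softmax_rows Z) (mat 1))))"

text \<open>
  A run of gradient descent for \<open>F\<close> inside the domain \<open>S\<close>, with arbitrary positive step sizes.
  \<open>GDERIV F x :> g\<close> says that \<open>F\<close> is (Frechet) differentiable at \<open>x\<close> with gradient \<open>g\<close>.
\<close>

definition gradient_descent_on ::
  "'a::real_inner set \<Rightarrow> ('a \<Rightarrow> real) \<Rightarrow> (nat \<Rightarrow> 'a) \<Rightarrow> bool" where
  "gradient_descent_on S F x \<longleftrightarrow>
     (\<forall>k. x k \<in> S) \<and>
     (\<forall>k. \<exists>g \<eta>. GDERIV F (x k) :> g \<and> 0 < \<eta> \<and> x (Suc k) = x k - \<eta> *\<^sub>R g)"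

end

theory Submission
  imports Defs
begin

text \<open>
  By Cramer's rule the entries of \<open>matrix_inv T\<close> are quotients of polynomials in the entries of
  \<open>T\<close>, so the loss is differentiable wherever \<open>T\<close> is invertible. In the image of the
  parametrization row \<open>i\<close> of \<open>T\<close> has diagonal entry \<open>-\<gamma>\<^sub>i\<^sup>2\<close> and row sum \<open>-\<gamma>\<^sub>i\<^sup>2 P\<^sub>i\<^sub>i < 0\<close>, where
  \<open>P\<close> is the row-wise softmax; hence \<open>T\<close> is strictly diagonally dominant and therefore invertible.
  The parameter space is open, so small gradient steps stay inside it.
\<close>

section \<open>Differentiation rules for vectors and matrices\<close>

lemma differentiable_prod:
  fixes f :: "'i \<Rightarrow> 'a::real_normed_vector \<Rightarrow> 'b::real_normed_field"
  assumes "\<And>i. i \<in> I \<Longrightarrow> f i differentiable (at x within S)"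
  shows "(\<lambda>x. \<Prod>i\<in>I. f i x) differentiable (at x within S)"
proof -
  from assms obtain f' where "\<And>i. i \<in> I \<Longrightarrow> (f i has_derivative f' i) (at x within S)"
    unfolding differentiable_def by metis
  then show ?thesis
    unfolding differentiable_def by (blast intro: has_derivative_prod)
qed

text \<open>Each basis vector of the product space is \<open>axis i u\<close> with \<open>u\<close>
  in the basis of the component space, so its coordinate function is a coordinate of one component.
  Components range over an arbitrary Euclidean space, so that two applications reduce a matrix to
  its rows and then to its entries.\<close>

lemma differentiable_vec_componentwise:
  fixes f :: "'a::real_normed_vector \<Rightarrow> 'b::euclidean_space ^ 'n"
  assumes "\<And>i. (\<lambda>x. f x $ i) differentiable (at x within S)"
  shows "f differentiable (at x within S)"
proof -
  have "(\<lambda>x. f x \<bullet> b) differentiable (at x within S)" if "b \<in> Basis" for b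
  proof -
    from that obtain i u where "b = axis i u" "u \<in> Basis"
      by (auto simp: Basis_vec_def)
    then show ?thesis
      using assms[of i] by (simp add: inner_axis)
  qed
  then show ?thesis
    unfolding differentiable_componentwise_within[of f] by blast
qed

lemma differentiable_vec_nth:
  fixes f :: "'a::real_normed_vector \<Rightarrow> 'b::real_normed_vector ^ 'n"
  assumes "f differentiable (at x within S)"
  shows "(\<lambda>x. f x $ i) differentiable (at x within S)"
  by (rule differentiable_compose[OF _ assms])
     (rule bounded_linear_imp_differentiable[OF bounded_linear_vec_nth])

lemma differentiable_fst:
  assumes "f differentiable (at x within S)"
  shows "(\<lambda>x. fst (f x)) differentiable (at x within S)"
  by (rule differentiable_compose[OF _ assms])
     (rule bounded_linear_imp_differentiable[OF bounded_linear_fst])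

lemma differentiable_snd:
  assumes "f differentiable (at x within S)"
  shows "(\<lambda>x. snd (f x)) differentiable (at x within S)"
  by (rule differentiable_compose[OF _ assms])
     (rule bounded_linear_imp_differentiable[OF bounded_linear_snd])

lemma differentiable_exp:
  fixes f :: "'a::real_normed_vector \<Rightarrow> real"
  assumes "f differentiable (at x within S)"
  shows "(\<lambda>x. exp (f x)) differentiable (at x within S)"
  using assms unfolding differentiable_def by (blast intro: has_derivative_exp)

text \<open>By the Leibniz formula the determinant is a finite sum of products of entries. The
  entrywise hypothesis suits matrices in which a column has been replaced.\<close>

lemma differentiable_det:
  fixes f :: "'a::real_normed_vector \<Rightarrow> real ^ 'n ^ 'n"
  assumes "\<And>i j. (\<lambda>x. f x $ i $ j) differentiable (at x within S)"
  shows "(\<lambda>x. det (f x)) differentiable (at x within S)"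
  unfolding det_def
  by (intro differentiable_sum ballI differentiable_mult differentiable_prod
        differentiable_const assms) (simp add: finite_permutations)

lemma differentiable_matrix_mult:
  fixes f :: "'a::real_normed_vector \<Rightarrow> real ^ 'n ^ 'm"
    and g :: "'a \<Rightarrow> real ^ 'k ^ 'n"
  assumes "f differentiable (at x within S)" "g differentiable (at x within S)"
  shows "(\<lambda>x. f x ** g x) differentiable (at x within S)"
  unfolding matrix_matrix_mult_def
  by (intro differentiable_vec_componentwise)
     (auto intro!: differentiable_sum differentiable_mult differentiable_vec_nth assms)

section \<open>Differentiability of the matrix inverse\<close>

lemma matrix_inv_right:
  fixes A :: "real ^ 'n ^ 'n"
  assumes "invertible A"
  shows "A ** matrix_inv A = mat 1"
  using assms unfolding invertible_def matrix_inv_def by (rule someI2_ex) blast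

text \<open>Column \<open>j\<close> of the inverse solves the linear system with right-hand side
  \<open>axis j 1\<close>; Cramer's rule gives its entry \<open>k\<close>.\<close>

lemma matrix_inv_cramer:
  fixes A :: "real ^ 'n ^ 'n"
  assumes "invertible A"
  shows "matrix_inv A $ k $ j =
    det (\<chi> i i'. if i' = k then axis j 1 $ i else A $ i $ i') / det A"
proof -
  have "A *v column j (matrix_inv A) = axis j 1"
    by (simp add: matrix_vector_mul_assoc matrix_inv_right[OF assms]
        flip: matrix_vector_mult_basis)
  then have "column j (matrix_inv A) =
      (\<chi> k. det (\<chi> i i'. if i' = k then axis j 1 $ i else A $ i $ i') / det A)"
    using assms by (simp add: cramer invertible_det_nz)
  then show ?thesis
    by (simp add: column_def vec_eq_iff)
qed

text \<open>Preimage of the nonzero reals under the continuous determinant. Openness makes the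
  Cramer quotient agree with \<open>matrix_inv\<close> on a whole neighbourhood of an invertible
  matrix.\<close>

lemma open_invertible: "open {A :: real ^ 'n ^ 'n. invertible A}"
proof -
  have "continuous_on UNIV (det :: real ^ 'n ^ 'n \<Rightarrow> real)"
    by (intro differentiable_imp_continuous_on)
       (auto simp: differentiable_on_def intro!: differentiable_det differentiable_vec_nth)
  then have "open {A :: real ^ 'n ^ 'n. det A \<noteq> 0}"
    by (intro open_Collect_neq continuous_intros)
  then show ?thesis
    by (simp add: invertible_det_nz)
qed

lemma differentiable_matrix_inv:
  fixes A :: "real ^ 'n ^ 'n"
  assumes "invertible A"
  shows "matrix_inv differentiable (at A)"
proof (intro differentiable_vec_componentwise)
  fix k j
  let ?N = "\<lambda>A. (\<chi> i i'. if i' = k then axis j 1 $ i else A $ i $ i') :: real ^ 'n ^ 'n"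
  have "(\<lambda>A. det (?N A) / det A) differentiable (at A)"
  proof (intro differentiable_divide differentiable_det)
    show "(\<lambda>A. ?N A $ i $ i') differentiable (at A)" for i i'
      \<comment> \<open>Column \<open>k\<close> of the numerator matrix is constant; every other
        entry is a coordinate of \<open>A\<close>.\<close>
      by (cases "i' = k") (simp_all add: differentiable_vec_nth)
  qed (use assms in \<open>auto simp: invertible_det_nz intro!: differentiable_vec_nth\<close>)
  then obtain D where D: "((\<lambda>A. det (?N A) / det A) has_derivative D) (at A)"
    unfolding differentiable_def by blast
  \<comment> \<open>The quotient represents the inverse only at invertible matrices; these form an
    open set around the given one, which suffices to transfer the derivative.\<close>
  have "((\<lambda>A. matrix_inv A $ k $ j) has_derivative D) (at A)"
    by (rule has_derivative_transform_within_open[OF D open_invertible])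
       (use assms in \<open>simp_all add: matrix_inv_cramer\<close>)
  then show "(\<lambda>A. matrix_inv A $ k $ j) differentiable (at A)"
    unfolding differentiable_def by blast
qed

lemma differentiable_mat_power:
  fixes f :: "'a::real_normed_vector \<Rightarrow> real ^ 'n ^ 'n"
  assumes "f differentiable (at x within S)"
  shows "(\<lambda>x. mat_power (f x) k) differentiable (at x within S)"
  by (induction k) (simp_all add: differentiable_matrix_mult assms)

section \<open>Differentiability of the moments and of the loss\<close>

lemma differentiable_moment:
  fixes \<alpha> :: "real ^ 'n" and T :: "real ^ 'n ^ 'n"
  assumes "invertible T"
  shows "moment i differentiable (at (\<alpha>, T))"
proof -
  \<comment> \<open>Projections replace the pattern on pairs, and finite sums replace the vector
    products, so that the differentiation rules apply factor by factor.\<close>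
  have moment: "moment i = (\<lambda>p :: 'n markovian. fact i * (- 1) ^ i *
      (\<Sum>j\<in>UNIV. \<Sum>k\<in>UNIV. mat_power (matrix_inv (snd p)) i $ k $ j * fst p $ k))"
    by (auto simp: fun_eq_iff inner_vec_def vector_matrix_mult_def vec_def mult.commute)
  have "(\<lambda>p. matrix_inv (snd p)) differentiable (at (\<alpha>, T))"
    by (rule differentiable_compose[where f = matrix_inv])
       (simp_all add: assms differentiable_matrix_inv differentiable_snd)
  then show ?thesis
    unfolding moment
    by (intro differentiable_mult differentiable_sum ballI differentiable_const
          differentiable_vec_nth differentiable_mat_power differentiable_fst differentiable_ident)
       simp_all
qed

lemma differentiable_moment_loss:
  fixes \<alpha> :: "real ^ 'n" and T :: "real ^ 'n ^ 'n"
  assumes "invertible T"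
  shows "moment_loss l w m differentiable (at (\<alpha>, T))"
proof -
  have "(\<lambda>p. moment_loss l w m p) differentiable (at (\<alpha>, T))"
    unfolding moment_loss_def
    by (intro differentiable_mult differentiable_sum ballI differentiable_power differentiable_diff
          differentiable_const differentiable_moment assms) simp
  then show ?thesis
    by simp
qed

section \<open>Softmax and differentiability of the parametrization\<close>

lemma sum_exp_pos: "0 < (\<Sum>j\<in>(UNIV :: 'n::finite set). exp (f j :: real))"
  by (intro sum_pos) auto

lemma softmax_pos: "0 < softmax v $ i"
  by (simp add: softmax_def sum_exp_pos)

lemma sum_softmax: "(\<Sum>i\<in>UNIV. softmax v $ i) = 1"
  using sum_exp_pos[of "\<lambda>j. v $ j"]
  by (simp add: softmax_def flip: sum_divide_distrib)

lemma differentiable_softmax: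
  assumes "f differentiable (at x within S)"
  shows "(\<lambda>x. softmax (f x)) differentiable (at x within S)"
proof (rule differentiable_vec_componentwise)
  have "(\<Sum>j\<in>UNIV. exp (f x $ j)) \<noteq> 0"
    using sum_exp_pos[of "\<lambda>j. f x $ j"] by simp
  then show "(\<lambda>x. softmax (f x) $ i) differentiable (at x within S)" for i
    unfolding softmax_def
    by (auto intro!: differentiable_divide differentiable_sum differentiable_exp
          differentiable_vec_nth assms)
qed

lemma differentiable_param_map:
  fixes \<theta> :: "'n::finite param"
  shows "param_map differentiable (at \<theta>)"
proof -
  have param_map: "param_map = (\<lambda>\<theta> :: 'n param. (softmax (fst \<theta>),
      diag_mat (\<chi> i. (fst (snd \<theta>) $ i)\<^sup>2) **
      (softmax_rows (snd (snd \<theta>)) -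
        (mat 1 + hadamard (softmax_rows (snd (snd \<theta>))) (mat 1)))))"
    by auto
  have proj: "(\<lambda>\<theta> :: 'n param. fst \<theta>) differentiable (at \<theta>)"
    "(\<lambda>\<theta> :: 'n param. fst (snd \<theta>)) differentiable (at \<theta>)"
    "(\<lambda>\<theta> :: 'n param. snd (snd \<theta>)) differentiable (at \<theta>)" for \<theta> :: "'n param"
    by (intro differentiable_fst differentiable_snd differentiable_ident)+
  have diag: "(\<lambda>\<theta> :: 'n param. diag_mat (\<chi> i. (fst (snd \<theta>) $ i)\<^sup>2)) differentiable (at \<theta>)" for \<theta>
  proof (intro differentiable_vec_componentwise)
    fix i j
    show "(\<lambda>\<theta> :: 'n param. diag_mat (\<chi> i. (fst (snd \<theta>) $ i)\<^sup>2) $ i $ j) differentiable (at \<theta>)"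
      unfolding diag_mat_def
      by (cases "i = j") (simp_all add: differentiable_vec_nth proj)
  qed
  have rows: "(\<lambda>\<theta> :: 'n param. softmax_rows (snd (snd \<theta>))) differentiable (at \<theta>)" for \<theta>
  proof (rule differentiable_vec_componentwise)
    fix i
    show "(\<lambda>\<theta> :: 'n param. softmax_rows (snd (snd \<theta>)) $ i) differentiable (at \<theta>)"
      unfolding softmax_rows_def
      by (simp add: row_def differentiable_softmax differentiable_vec_nth proj)
  qed
  have had: "(\<lambda>\<theta> :: 'n param. hadamard (softmax_rows (snd (snd \<theta>))) (mat 1))
      differentiable (at \<theta>)" for \<theta>
    unfolding hadamard_def
    by (intro differentiable_vec_componentwise)
       (simp add: differentiable_vec_nth rows)
  show ?thesis
    unfolding param_map
    by (intro differentiable_Pair differentiable_matrix_mult differentiable_softmax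
          differentiable_diff differentiable_add differentiable_const proj diag rows had)
qed

section \<open>The image of the parametrization consists of PH distributions\<close>

lemma diag_mat_mult_nth: "(diag_mat d ** A) $ i $ j = d $ i * A $ i $ j"
  by (simp add: matrix_matrix_mult_def diag_mat_def if_distrib[of "\<lambda>x. x * _"] cong: if_cong)

text \<open>With P the row-wise softmax, subtracting the Hadamard term cancels the diagonal of P,
  and subtracting the identity then leaves -1 there. Entries off the diagonal are those of
  P.\<close>

lemma param_map_T_nth:
  "snd (param_map (a, \<gamma>, Z)) $ i $ j =
    (\<gamma> $ i)\<^sup>2 * (if i = j then - 1 else softmax (row i Z) $ j)"
  by (simp add: diag_mat_mult_nth hadamard_def softmax_rows_def mat_def)

text \<open>A softmax row sums to 1, so its part off the diagonal contributes 1 - P_ii, and the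
  diagonal entry -1 cancels the 1.\<close>

lemma sum_param_map_T_row:
  "(\<Sum>j\<in>UNIV. snd (param_map (a, \<gamma>, Z)) $ i $ j) = - ((\<gamma> $ i)\<^sup>2 * softmax (row i Z) $ i)"
proof -
  have "(\<Sum>j\<in>UNIV. if i = j then - 1 else softmax (row i Z) $ j)
      = - 1 + (\<Sum>j\<in>UNIV - {i}. softmax (row i Z) $ j)"
    by (subst sum.remove[of _ i]) (auto intro: sum.cong)
  also have "\<dots> = - softmax (row i Z) $ i"
    using sum_softmax[of "row i Z"] by (simp add: sum_diff1)
  finally show ?thesis
    by (simp add: param_map_T_nth del: param_map.simps flip: sum_distrib_left)
qed

text \<open>The Levy-Desplanques theorem. For a nonzero kernel vector, take the equation whose index
  is a coordinate of largest modulus: its diagonal term would have to balance the remaining terms,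
  which are too small in total.\<close>

lemma invertible_strictly_diagonally_dominant:
  fixes A :: "real ^ 'n ^ 'n"
  assumes dom: "\<And>i. (\<Sum>j\<in>UNIV - {i}. \<bar>A $ i $ j\<bar>) < \<bar>A $ i $ i\<bar>"
  shows "invertible A"
proof -
  have "x = 0" if ker: "A *v x = 0" for x
  proof (rule ccontr)
    assume "x \<noteq> 0"
    have "Max (range (\<lambda>i. \<bar>x $ i\<bar>)) \<in> range (\<lambda>i. \<bar>x $ i\<bar>)"
      by (intro Max_in) auto
    then obtain i where "Max (range (\<lambda>i. \<bar>x $ i\<bar>)) = \<bar>x $ i\<bar>"
      by blast
    then have i: "\<bar>x $ j\<bar> \<le> \<bar>x $ i\<bar>" for j
      by (metis Max_ge finite finite_imageI rangeI)
    obtain k where "x $ k \<noteq> 0"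
      using \<open>x \<noteq> 0\<close> by (auto simp: vec_eq_iff)
    then have pos: "0 < \<bar>x $ i\<bar>"
      using i[of k] by linarith
    have "0 = (\<Sum>j\<in>UNIV. A $ i $ j * x $ j)"
      using ker by (simp add: vec_eq_iff matrix_vector_mult_def)
    also have "\<dots> = A $ i $ i * x $ i + (\<Sum>j\<in>UNIV - {i}. A $ i $ j * x $ j)"
      by (simp add: sum.remove[of UNIV i])
    finally have "\<bar>A $ i $ i\<bar> * \<bar>x $ i\<bar> = \<bar>\<Sum>j\<in>UNIV - {i}. A $ i $ j * x $ j\<bar>"
      by (simp flip: abs_mult)
    also have "\<dots> \<le> (\<Sum>j\<in>UNIV - {i}. \<bar>A $ i $ j\<bar> * \<bar>x $ j\<bar>)"
      by (rule order_trans[OF sum_abs]) (simp add: abs_mult)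
    also have "\<dots> \<le> (\<Sum>j\<in>UNIV - {i}. \<bar>A $ i $ j\<bar>) * \<bar>x $ i\<bar>"
      unfolding sum_distrib_right by (intro sum_mono mult_left_mono i) simp
    \<comment> \<open>Strictness survives the multiplication because the largest modulus is
      positive.\<close>
    also have "\<dots> < \<bar>A $ i $ i\<bar> * \<bar>x $ i\<bar>"
      using dom pos by (intro mult_strict_right_mono)
    finally show False
      by simp
  qed
  then show ?thesis
    by (simp add: invertible_left_inverse matrix_left_invertible_ker)
qed

lemma is_PH_param_map:
  assumes "\<theta> \<in> param_space"
  shows "is_PH (param_map \<theta>)"
proof -
  obtain a \<gamma> Z where \<theta>: "\<theta> = (a, \<gamma>, Z)"
    by (cases \<theta>)
  define T where "T = snd (param_map \<theta>)"
  have \<gamma>: "0 < (\<gamma> $ i)\<^sup>2" for i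
    using assms by (simp add: \<theta> param_space_def)
  have diag: "T $ i $ i = - (\<gamma> $ i)\<^sup>2" for i
    by (simp add: T_def \<theta> param_map_T_nth del: param_map.simps)
  have off_diag: "0 \<le> T $ i $ j" if "i \<noteq> j" for i j
    using that softmax_pos[of "row i Z" j]
    by (simp add: T_def \<theta> param_map_T_nth del: param_map.simps)
  have row_sum: "(\<Sum>j\<in>UNIV. T $ i $ j) < 0" for i
    using \<gamma>[of i] softmax_pos[of "row i Z" i]
    by (simp add: T_def \<theta> sum_param_map_T_row del: param_map.simps)
  have "invertible T"
  proof (rule invertible_strictly_diagonally_dominant)
    fix i
    have "(\<Sum>j\<in>UNIV - {i}. \<bar>T $ i $ j\<bar>) = (\<Sum>j\<in>UNIV - {i}. T $ i $ j)"
      using off_diag by (intro sum.cong) auto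
    \<comment> \<open>This is the negative row sum with the diagonal entry moved to the other
      side.\<close>
    also have "\<dots> < - T $ i $ i"
      using row_sum[of i] by (simp add: sum_diff1)
    also have "\<dots> = \<bar>T $ i $ i\<bar>"
      by (simp add: diag)
    finally show "(\<Sum>j\<in>UNIV - {i}. \<bar>T $ i $ j\<bar>) < \<bar>T $ i $ i\<bar>" .
  qed
  then have "is_PH (softmax a, T)"
    using off_diag row_sum by (auto simp: softmax_pos sum_softmax less_imp_le)
  then show ?thesis
    by (simp add: T_def \<theta>)
qed

lemma differentiable_moment_loss_param_map:
  assumes "\<theta> \<in> param_space"
  shows "(moment_loss l w m \<circ> param_map) differentiable (at \<theta>)"
proof (rule differentiable_chain_at[OF differentiable_param_map])
  obtain \<alpha> T where "param_map \<theta> = (\<alpha>, T)"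
    by fastforce
  \<comment> \<open>Being PH includes invertibility of the matrix component, which is what
    differentiability of the loss requires.\<close>
  then show "moment_loss l w m differentiable (at (param_map \<theta>))"
    using is_PH_param_map[OF assms] by (simp add: differentiable_moment_loss)
qed

section \<open>Gradients and descent steps in the parameter space\<close>

lemma open_param_space: "open (param_space :: 'n::finite param set)"
proof -
  have eq: "(param_space :: 'n param set) = (\<Inter>i. {\<theta>. fst (snd \<theta>) $ i \<noteq> 0})"
    by (auto simp: param_space_def)
  show ?thesis
    unfolding eq by (intro open_INT finite ballI open_Collect_neq continuous_intros)
qed

text \<open>Riesz representation in finite dimension: expanding \<open>h\<close> in the orthonormal
  basis shows that the derivative is the inner product with the vector whose coordinates are the
  values \<open>f' b\<close>.\<close>

lemma differentiable_imp_GDERIV: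
  fixes f :: "'a::euclidean_space \<Rightarrow> real"
  assumes "f differentiable (at x)"
  obtains g where "GDERIV f x :> g"
proof -
  obtain f' where f': "(f has_derivative f') (at x)"
    using assms unfolding differentiable_def by blast
  then interpret linear f'
    by (rule has_derivative_linear)
  have "f' h = h \<bullet> (\<Sum>b\<in>Basis. f' b *\<^sub>R b)" for h
  proof -
    have "f' h = f' (\<Sum>b\<in>Basis. (h \<bullet> b) *\<^sub>R b)"
      by (simp add: euclidean_representation)
    then show ?thesis
      by (simp add: sum scale inner_sum_right mult.commute)
  qed
  then have "f' = (\<lambda>h. h \<bullet> (\<Sum>b\<in>Basis. f' b *\<^sub>R b))"
    by blast
  then show ?thesis
    using f' that unfolding gderiv_def by metis
qed

text \<open>Along the line \<eta> \<mapsto> x - \<eta> g the function has derivative -(g \<bullet>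
  g) at 0, negative for nonzero \<open>g\<close>, so short steps decrease it. Openness of
  \<open>S\<close> keeps short steps inside.\<close>

lemma GDERIV_descent:
  fixes F :: "'a::real_inner \<Rightarrow> real"
  assumes F: "GDERIV F x :> g" and S: "open S" "x \<in> S"
  shows "\<exists>\<epsilon>>0. \<forall>\<eta>. 0 < \<eta> \<and> \<eta> < \<epsilon> \<longrightarrow>
    x - \<eta> *\<^sub>R g \<in> S \<and> (g \<noteq> 0 \<longrightarrow> F (x - \<eta> *\<^sub>R g) < F x)"
proof -
  have "open ((\<lambda>\<eta>. x - \<eta> *\<^sub>R g) -` S)"
    by (intro open_vimage S continuous_intros)
  moreover have "0 \<in> (\<lambda>\<eta>. x - \<eta> *\<^sub>R g) -` S"
    using S by simp
  ultimately obtain e where "0 < e" "ball 0 e \<subseteq> (\<lambda>\<eta>. x - \<eta> *\<^sub>R g) -` S"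
    by (rule openE)
  then have e: "0 < e" "\<And>\<eta>. \<bar>\<eta>\<bar> < e \<Longrightarrow> x - \<eta> *\<^sub>R g \<in> S"
    by (auto simp: subset_iff)
  have "\<exists>d>0. \<forall>h>0. h < d \<longrightarrow> F (x - h *\<^sub>R g) < F x" if "g \<noteq> 0"
  proof -
    have "((\<lambda>\<eta>. F (x - \<eta> *\<^sub>R g)) has_derivative (\<lambda>h. (- h *\<^sub>R g) \<bullet> g)) (at 0)"
      by (rule has_derivative_compose[of "\<lambda>\<eta>. x - \<eta> *\<^sub>R g" _ 0 UNIV F])
         (use F in \<open>auto simp: gderiv_def intro!: derivative_eq_intros\<close>)
    then have "((\<lambda>\<eta>. F (x - \<eta> *\<^sub>R g)) has_real_derivative - (g \<bullet> g)) (at 0)"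
      by (rule has_derivative_imp_has_field_derivative) simp
    from has_real_derivative_neg_dec_right[OF this] that show ?thesis
      by simp
  qed
  \<comment> \<open>A single \<open>d\<close> has to cover both cases; for \<open>g = 0\<close> the
    decrease condition is vacuous and 1 serves.\<close>
  then obtain d where "0 < d" "\<And>h. g \<noteq> 0 \<Longrightarrow> 0 < h \<Longrightarrow> h < d \<Longrightarrow> F (x - h *\<^sub>R g) < F x"
    by (metis zero_less_one)
  with e show ?thesis
    by (intro exI[of _ "min d e"]) auto
qed

text \<open>The claim about descent runs follows because the definition of a run keeps every iterate
  in \<open>param_space\<close>. The claim about small steps shows that this demand can be met: from
  each parameter point a gradient step inside the domain exists, and it lowers the loss unless the
  gradient vanishes.\<close>

theorem corollary2:
  fixes l :: nat and w m :: "nat \<Rightarrow> real"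
  shows
    "(\<forall>(\<alpha> :: real ^ 'n) (T :: real ^ 'n ^ 'n). invertible T \<longrightarrow>
        moment_loss l w m differentiable (at (\<alpha>, T))) \<and>
     (\<forall>\<theta> \<in> (param_space :: 'n::finite param set).
        (moment_loss l w m \<circ> param_map) differentiable (at \<theta>)) \<and>
     (\<forall>\<theta> \<in> (param_space :: 'n param set).
        \<exists>g. GDERIV (moment_loss l w m \<circ> param_map) \<theta> :> g \<and>
          (\<exists>\<epsilon>>0. \<forall>\<eta>. 0 < \<eta> \<and> \<eta> < \<epsilon> \<longrightarrow>
             \<theta> - \<eta> *\<^sub>R g \<in> param_space \<and>
             (g \<noteq> 0 \<longrightarrow> (moment_loss l w m \<circ> param_map) (\<theta> - \<eta> *\<^sub>R g)
                        < (moment_loss l w m \<circ> param_map) \<theta>))) \<and>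
     (\<forall>x :: nat \<Rightarrow> 'n param.
        gradient_descent_on param_space (moment_loss l w m \<circ> param_map) x \<longrightarrow>
        (\<forall>k. is_PH (param_map (x k)))) \<and>
     (\<forall>\<theta> \<in> (param_space :: 'n param set). is_PH (param_map \<theta>))"
proof (intro conjI allI ballI impI)
  fix \<theta> :: "'n param"
  assume \<theta>: "\<theta> \<in> param_space"
  obtain g where "GDERIV (moment_loss l w m \<circ> param_map) \<theta> :> g"
    using differentiable_imp_GDERIV[OF differentiable_moment_loss_param_map[OF \<theta>]] .
  with GDERIV_descent[OF this open_param_space \<theta>]
  show "\<exists>g. GDERIV (moment_loss l w m \<circ> param_map) \<theta> :> g \<and>
      (\<exists>\<epsilon>>0. \<forall>\<eta>. 0 < \<eta> \<and> \<eta> < \<epsilon> \<longrightarrow>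
         \<theta> - \<eta> *\<^sub>R g \<in> param_space \<and>
         (g \<noteq> 0 \<longrightarrow> (moment_loss l w m \<circ> param_map) (\<theta> - \<eta> *\<^sub>R g)
                    < (moment_loss l w m \<circ> param_map) \<theta>))"
    by blast
qed (simp_all add: differentiable_moment_loss differentiable_moment_loss_param_map
      is_PH_param_map gradient_descent_on_def)

end
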